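(* Let $k\ge1$ and let $n_1,\dots,n_k\geq 2$ be integers. Then $\text{sat}^*(n,K_{n_1,\dots,n_k})=O(n)$.
   Context: $K_{n_1,\dots,n_k}$ denotes the complete $k$-layered poset: its elements are partitioned into layers $L_1,\dots,L_k$ with $|L_i|=n_i$ ($L_1$ the bottom layer), each layer is an antichain, and $x<y$ whenever $x\in L_i$, $y\in L_j$ with $i<j$. A poset $\mathcal Q$ contains an induced copy of a poset $\mathcal P$ if there is an injective map $f:\mathcal P\to\mathcal Q$ with $f(x)\le f(y)$ iff $x\le y$. A family $\mathcal F$ of subsets of $[n]$ (ordered by inclusion) is $\mathcal P$-saturated if $\mathcal F$ contains no induced copy of $\mathcal P$ but for every $S\subseteq[n]$ with $S\notin\mathcal F$, $\mathcal F\cup\{S\}$ contains an induced copy of $\mathcal P$; $\text{sat}^*(n,\mathcal P)$ is the minimum size of such a family. *)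

theory Defs
  imports Complex_Main "HOL-Library.Landau_Symbols"
begin

text \<open>A poset is a reflexive order relation \<open>r\<close>; its set of elements is \<^term>\<open>Field r\<close>.\<close>

definition layer_elements :: "nat list \<Rightarrow> (nat \<times> nat) set" where
  "layer_elements ns = {(i, a). i < length ns \<and> a < ns ! i}"

text \<open>The element \<open>(i, a)\<close> lies in the layer with (0-based) index \<open>i\<close>, index 0 being the bottom.\<close>

definition complete_layered_poset :: "nat list \<Rightarrow> (nat \<times> nat) rel" where
  "complete_layered_poset ns =
     relation_of (\<lambda>x y. x = y \<or> fst x < fst y) (layer_elements ns)"

lemma Field_complete_layered_poset: "Field (complete_layered_poset ns) = layer_elements ns"
  by (auto simp: complete_layered_poset_def relation_of_def Field_def)

lemma partial_order_complete_layered_poset: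
  "partial_order_on (layer_elements ns) (complete_layered_poset ns)"
  unfolding partial_order_on_def preorder_on_def complete_layered_poset_def relation_of_def
  by (auto simp: refl_on_def trans_def antisym_def)

definition contains_induced_copy :: "'b rel \<Rightarrow> 'a rel \<Rightarrow> bool" where
  "contains_induced_copy Q P \<longleftrightarrow>
     (\<exists>f. inj_on f (Field P) \<and> f ` Field P \<subseteq> Field Q \<and>
        (\<forall>x\<in>Field P. \<forall>y\<in>Field P. (f x, f y) \<in> Q \<longleftrightarrow> (x, y) \<in> P))"

abbreviation inclusion_order :: "'a set set \<Rightarrow> 'a set rel" where
  "inclusion_order F \<equiv> relation_of (\<subseteq>) F"

lemma Field_inclusion_order: "Field (inclusion_order F) = F"
  by (auto simp: relation_of_def Field_def)

definition saturated :: "nat \<Rightarrow> 'a rel \<Rightarrow> nat set set \<Rightarrow> bool" where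
  "saturated n P F \<longleftrightarrow>
     F \<subseteq> Pow {1..n} \<and>
     \<not> contains_induced_copy (inclusion_order F) P \<and>
     (\<forall>S. S \<subseteq> {1..n} \<and> S \<notin> F \<longrightarrow>
        contains_induced_copy (inclusion_order (insert S F)) P)"

definition sat_star :: "nat \<Rightarrow> 'a rel \<Rightarrow> nat" where
  "sat_star n P = (LEAST m. \<exists>F. saturated n P F \<and> card F = m)"

text \<open>The minimum is attained as soon as the poset is nonempty.\<close>

lemma ex_saturated:
  assumes "Field P \<noteq> {}"
  shows "\<exists>F. saturated n P F"
proof -
  define free where "free F \<longleftrightarrow> \<not> contains_induced_copy (inclusion_order F) P"
    for F :: "nat set set"
  define A where "A = {F. F \<subseteq> Pow {1..n} \<and> free F}"
  have "finite A"
    unfolding A_def by (rule finite_subset[of _ "Pow (Pow {1..n})"]) auto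
  moreover have "A \<noteq> {}"
  proof -
    have "free {}"
      unfolding free_def contains_induced_copy_def Field_inclusion_order
      using assms by simp
    then show ?thesis
      unfolding A_def by blast
  qed
  ultimately obtain F where F: "F \<in> A" and max: "\<And>G. G \<in> A \<Longrightarrow> F \<subseteq> G \<Longrightarrow> F = G"
    using finite_has_maximal[of A] by metis
  have "\<not> free (insert S F)" if S: "S \<subseteq> {1..n}" "S \<notin> F" for S
  proof
    assume "free (insert S F)"
    then have "insert S F \<in> A"
      using F S(1) by (simp add: A_def)
    from max[OF this subset_insertI] S(2) show False
      by (metis insertI1)
  qed
  moreover have "F \<subseteq> Pow {1..n}" "free F"
    using F by (simp_all add: A_def)
  ultimately have "saturated n P F"
    by (simp add: saturated_def free_def)
  then show ?thesis ..
qed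

lemma sat_star_attained:
  assumes "Field P \<noteq> {}"
  shows "\<exists>F. saturated n P F \<and> card F = sat_star n P"
  unfolding sat_star_def by (rule LeastI_ex) (use ex_saturated[OF assms] in blast)

lemma sat_star_le: "saturated n P F \<Longrightarrow> sat_star n P \<le> card F"
  unfolding sat_star_def by (rule Least_le) blast

end

theory Submission
  imports Defs
begin

text \<open>
  Since any family free of the poset extends to a saturated one, it suffices to find a free family
  all of whose free extensions have linear size. Fix nested constant-size sets \<open>Q 0 \<subset> \<dots> \<subset> Q k\<close> and
  thresholds \<open>2 N j\<close>, and say \<open>U j X\<close> if \<open>X\<close> meets \<open>Q j\<close> in at least \<open>2 N j\<close> points. The base family
  contains, just below each threshold, sets \<open>G j\<close> inside \<open>Q j\<close>, and, exactly at it, sets \<open>H j\<close>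
  containing the whole complement of \<open>Q j\<close>. If \<open>U j X\<close> holds, then the first \<open>j\<close> layers embed in \<open>G\<close>
  below \<open>X\<close>; otherwise the remaining \<open>k - j\<close> layers embed in \<open>H\<close> above \<open>X \<union> (E - Q k)\<close>. Hence, among
  the members of a free extension with a given trace on \<open>Q k\<close>, there is no antichain as large as a
  suitable layer; in particular boundedly many of them have any given cardinality, which bounds their
  number linearly.

  The base family is itself free: two incomparable members of \<open>G\<close> have a union crossing the next
  threshold, and two incomparable members of \<open>H\<close> have an intersection falling below one. A layer
  containing both some \<open>h\<close> in \<open>H\<close> and some \<open>g\<close> in \<open>G l\<close> would force \<open>Q l - Q (l - 1) \<subseteq> g\<close>.
\<close>

section \<open>Induced copies as stacks of antichains\<close>

definition incomparable_family :: "'a set set \<Rightarrow> bool" where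
  "incomparable_family A \<longleftrightarrow> (\<forall>x\<in>A. \<forall>y\<in>A. x \<subseteq> y \<longrightarrow> x = y)"

definition tower :: "nat list \<Rightarrow> nat set \<Rightarrow> (nat \<Rightarrow> 'a set set) \<Rightarrow> bool" where
  "tower ns I L \<longleftrightarrow>
     (\<forall>i\<in>I. card (L i) = ns ! i \<and> incomparable_family (L i)) \<and>
     (\<forall>i\<in>I. \<forall>j\<in>I. i < j \<longrightarrow> (\<forall>x\<in>L i. \<forall>y\<in>L j. x \<subseteq> y))"

lemma tower_le:
  "tower ns I L \<Longrightarrow> i < j \<Longrightarrow> i \<in> I \<Longrightarrow> j \<in> I \<Longrightarrow> x \<in> L i \<Longrightarrow> y \<in> L j \<Longrightarrow> x \<subseteq> y"
  by (simp add: tower_def)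

lemma tower_insert:
  assumes L: "tower ns I L" and "m \<notin> I" "card A = ns ! m" "incomparable_family A"
    and below: "\<And>i x y. i \<in> I \<Longrightarrow> i < m \<Longrightarrow> x \<in> L i \<Longrightarrow> y \<in> A \<Longrightarrow> x \<subseteq> y"
    and above: "\<And>i x y. i \<in> I \<Longrightarrow> m < i \<Longrightarrow> x \<in> A \<Longrightarrow> y \<in> L i \<Longrightarrow> x \<subseteq> y"
  shows "tower ns (insert m I) (L(m := A))"
  unfolding tower_def
proof (intro conjI ballI impI)
  fix i j x y
  assume "i \<in> insert m I" "j \<in> insert m I" "i < j" "x \<in> (L(m := A)) i" "y \<in> (L(m := A)) j"
  then show "x \<subseteq> y"
    using tower_le[OF L, of i j x y] below[of i x y] above[of j x y] by (auto split: if_splits)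
qed (use assms(2-4) L in \<open>auto simp: tower_def\<close>)

lemma contains_induced_copy_imp_tower:
  assumes "contains_induced_copy (inclusion_order F) (complete_layered_poset ns)"
  shows "\<exists>L. tower ns {..<length ns} L \<and> (\<forall>i<length ns. L i \<subseteq> F)"
proof -
  obtain f where f: "inj_on f (layer_elements ns) \<and> f ` layer_elements ns \<subseteq> F \<and>
      (\<forall>x\<in>layer_elements ns. \<forall>y\<in>layer_elements ns.
        (f x, f y) \<in> inclusion_order F \<longleftrightarrow> (x, y) \<in> complete_layered_poset ns)"
    using assms unfolding contains_induced_copy_def Field_inclusion_order
      Field_complete_layered_poset by (elim exE)
  then have inj: "inj_on f (layer_elements ns)" and im: "f ` layer_elements ns \<subseteq> F" by simp_all
  have ord: "f x \<subseteq> f y \<longleftrightarrow> x = y \<or> fst x < fst y"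
    if "x \<in> layer_elements ns" "y \<in> layer_elements ns" for x y
    using bspec[OF bspec[OF conjunct2[OF conjunct2[OF f]] that(1)] that(2)] im that
    by (auto simp: relation_of_def complete_layered_poset_def)
  define L where "L i = f ` ({i} \<times> {..<ns ! i})" for i
  have sub: "{i} \<times> {..<ns ! i} \<subseteq> layer_elements ns" if "i < length ns" for i
    using that by (auto simp: layer_elements_def)
  have "card (L i) = ns ! i" if "i < length ns" for i
    unfolding L_def using card_image[OF inj_on_subset[OF inj sub[OF that]]]
    by (simp add: card_cartesian_product)
  moreover have "incomparable_family (L i)" if "i < length ns" for i
    using sub[OF that] ord unfolding incomparable_family_def L_def by fastforce
  moreover have "x \<subseteq> y"
    if ij: "i < length ns" "j < length ns" "i < j" and xy: "x \<in> L i" "y \<in> L j" for i j x y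
  proof -
    obtain a b where "x = f (i, a)" "y = f (j, b)" "a < ns ! i" "b < ns ! j"
      using xy by (auto simp: L_def)
    then show ?thesis using ord[of "(i, a)" "(j, b)"] ij by (simp add: layer_elements_def)
  qed
  moreover have "L i \<subseteq> F" if "i < length ns" for i
    using sub[OF that] im unfolding L_def by blast
  ultimately show ?thesis
    unfolding tower_def by (intro exI[of _ L]) auto
qed

text \<open>Strictness: if \<open>y\<close> in a higher layer were contained in \<open>x\<close> in
  a lower one, then \<open>y \<subseteq> x \<subseteq> y'\<close> for a second member
  \<open>y'\<close> of the higher layer, contradicting incomparability.\<close>

lemma tower_imp_contains_induced_copy:
  assumes "tower ns {..<length ns} L" and sub: "\<forall>i<length ns. L i \<subseteq> F"
    and ge2: "\<forall>m\<in>set ns. 2 \<le> m"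
  shows "contains_induced_copy (inclusion_order F) (complete_layered_poset ns)"
proof -
  have card: "card (L i) = ns ! i" and inc: "incomparable_family (L i)" if "i < length ns" for i
    using assms(1) that by (auto simp: tower_def)
  have below: "x \<subseteq> y" if "i < j" "j < length ns" "x \<in> L i" "y \<in> L j" for i j x y
    using tower_le[OF assms(1), of i j x y] that by simp
  have strict: "\<not> y \<subseteq> x" if ij: "i < j" "j < length ns" and x: "x \<in> L i" and y: "y \<in> L j" for i j x y
  proof
    assume "y \<subseteq> x"
    have "1 < card (L j)" using card[OF ij(2)] ge2 nth_mem[OF ij(2)] by fastforce
    then obtain y' where y': "y' \<in> L j" "y' \<noteq> y"
      by (metis card.infinite card_le_Suc0_iff_eq leD not_less_zero One_nat_def)
    have "y \<subseteq> y'" using \<open>y \<subseteq> x\<close> below[OF ij x y'(1)] by blast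
    then show False using inc[OF ij(2)] y y' by (auto simp: incomparable_family_def)
  qed
  have "\<exists>b. bij_betw b {0..<ns ! i} (L i)" if "i < length ns" for i
  proof -
    have "0 < card (L i)" using card[OF that] ge2 nth_mem[OF that] by fastforce
    then show ?thesis
      using ex_bij_betw_nat_finite[of "L i"] card[OF that] card_gt_0_iff by metis
  qed
  then obtain b where b: "\<And>i. i < length ns \<Longrightarrow> bij_betw (b i) {0..<ns ! i} (L i)"
    by metis
  define f where "f = (\<lambda>(i, a). b i a)"
  have mem: "f x \<in> L (fst x)" if "x \<in> layer_elements ns" for x
    using that b bij_betwE unfolding layer_elements_def f_def by fastforce
  have ord: "f x \<subseteq> f y \<longleftrightarrow> x = y \<or> fst x < fst y"
    if x: "x \<in> layer_elements ns" and y: "y \<in> layer_elements ns" for x y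
  proof -
    have len: "fst x < length ns" "fst y < length ns"
      using x y by (auto simp: layer_elements_def)
    consider "fst x < fst y" | "fst y < fst x" | "fst x = fst y" by linarith
    then show ?thesis
    proof cases
      case 1
      then show ?thesis using below[OF 1 len(2) mem[OF x] mem[OF y]] by blast
    next
      case 2
      then show ?thesis using strict[OF 2 len(1) mem[OF y] mem[OF x]] by auto
    next
      case 3
      have "x = y" if "f x \<subseteq> f y"
      proof -
        have "f x = f y"
          using inc[OF len(1)] mem[OF x] mem[OF y] 3 that by (auto simp: incomparable_family_def)
        then have "b (fst x) (snd x) = b (fst x) (snd y)"
          using 3 by (simp add: f_def split_beta)
        moreover have "snd x \<in> {0..<ns ! fst x}" "snd y \<in> {0..<ns ! fst x}"
          using x y 3 by (auto simp: layer_elements_def)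
        ultimately have "snd x = snd y"
          using b[OF len(1)] by (meson bij_betw_imp_inj_on inj_onD)
        then show ?thesis using 3 by (simp add: prod_eq_iff)
      qed
      then show ?thesis using 3 by auto
    qed
  qed
  have im: "f x \<in> F" if "x \<in> layer_elements ns" for x
    using mem[OF that] sub that by (fastforce simp: layer_elements_def)
  have "inj_on f (layer_elements ns)"
    by (rule inj_onI) (metis ord order_refl less_asym)
  then show ?thesis
    unfolding contains_induced_copy_def Field_inclusion_order Field_complete_layered_poset
    using im ord by (intro exI[of _ f]) (auto simp: relation_of_def complete_layered_poset_def)
qed

section \<open>Saturated extensions and counting by cardinality\<close>

lemma ex_saturated_superset:
  assumes "F0 \<subseteq> Pow {1..n}" "\<not> contains_induced_copy (inclusion_order F0) P"
  shows "\<exists>F. F0 \<subseteq> F \<and> saturated n P F"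
proof -
  define A where "A = {F. F \<subseteq> Pow {1..n} \<and> \<not> contains_induced_copy (inclusion_order F) P}"
  have "finite A"
    unfolding A_def by (rule finite_subset[of _ "Pow (Pow {1..n})"]) auto
  moreover have "F0 \<in> A" using assms by (simp add: A_def)
  ultimately obtain F where F: "F \<in> A" "F0 \<subseteq> F" and max: "\<And>G. G \<in> A \<Longrightarrow> F \<subseteq> G \<Longrightarrow> F = G"
    using finite_has_maximal2[of A F0] by metis
  have "contains_induced_copy (inclusion_order (insert S F)) P"
    if S: "S \<subseteq> {1..n}" "S \<notin> F" for S
  proof (rule ccontr)
    assume "\<not> ?thesis"
    then have "insert S F \<in> A" using F(1) S(1) by (simp add: A_def)
    from max[OF this subset_insertI] S(2) show False by (metis insertI1)
  qed
  then show ?thesis using F by (auto simp: saturated_def A_def)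
qed

text \<open>Distinct finite sets of equal size are incomparable, so each of the \<open>n + 1\<close>
  possible sizes occurs at most \<open>m\<close> times.\<close>

lemma card_le_if_no_large_incomparable_subfamily:
  fixes S :: "nat set set"
  assumes S: "S \<subseteq> Pow {1..n}"
    and no: "\<And>A. A \<subseteq> S \<Longrightarrow> incomparable_family A \<Longrightarrow> card A \<noteq> m"
  shows "card S \<le> m * (n + 1)"
proof -
  have fin: "finite S" using S by (rule finite_subset) simp
  have finE: "finite x" if "x \<in> S" for x
    using S that by (meson PowD finite_atLeastAtMost finite_subset subsetD)
  have "card {x \<in> S. card x = s} \<le> m" for s
  proof (rule ccontr)
    assume "\<not> ?thesis"
    then obtain A where A: "A \<subseteq> {x \<in> S. card x = s}" "card A = m"
      by (meson obtain_subset_with_card_n nat_le_linear)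
    have "incomparable_family A"
      unfolding incomparable_family_def
    proof (intro ballI impI)
      fix x y assume "x \<in> A" "y \<in> A" "x \<subseteq> y"
      then show "x = y" using A(1) finE[of y] card_subset_eq[of y x] by auto
    qed
    then show False using no[of A] A by blast
  qed
  moreover have "S = (\<Union>s\<in>{..n}. {x \<in> S. card x = s})"
  proof -
    have "card x \<le> n" if "x \<in> S" for x
      using S that card_mono[of "{1..n}" x] by auto
    then show ?thesis by auto
  qed
  ultimately show ?thesis
    using card_UN_le[of "{..n}" "\<lambda>s. {x \<in> S. card x = s}"]
      sum_bounded_above[of "{..n}" "\<lambda>s. card {x \<in> S. card x = s}" m]
    by (simp add: mult.commute)
qed

section \<open>Nested sets, thresholds and the base family\<close>

locale layered_construction =
  fixes ns :: "nat list" and N n :: nat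
  assumes ge2: "\<And>m. m \<in> set ns \<Longrightarrow> 2 \<le> m"
    and leN: "\<And>m. m \<in> set ns \<Longrightarrow> m \<le> N"
    and large: "3 * N * length ns < n"
begin

abbreviation k :: nat where "k \<equiv> length ns"

abbreviation E :: "nat set" where "E \<equiv> {1..n}"

text \<open>Each step adds \<open>N\<close> points, half the growth of the threshold in
  \<open>U\<close>. The initial \<open>2 * N * k\<close> points leave, for \<open>j < k\<close>, at
  least \<open>N\<close> points of \<open>Q j\<close> outside any subset of size
  \<open>2 * N * j - 1\<close>. Since \<open>Q k\<close> has \<open>3 * N * k < n\<close> points,
  \<open>n\<close> lies outside all \<open>Q j\<close> with \<open>j \<le> k\<close>.\<close>

definition Q :: "nat \<Rightarrow> nat set" where "Q j = {1..2 * N * k + N * j}"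

definition U :: "nat \<Rightarrow> nat set \<Rightarrow> bool" where "U j X \<longleftrightarrow> 2 * N * j \<le> card (X \<inter> Q j)"

text \<open>The last condition on \<open>g\<close> excludes layers of a copy that mix \<open>G\<close> and \<open>H\<close>.\<close>

definition G :: "nat \<Rightarrow> nat set set" where
  "G j = {g. g \<subseteq> Q j \<and> card g + 1 = 2 * N * j \<and> \<not> Q j - Q (j - 1) \<subseteq> g}"

definition H :: "nat \<Rightarrow> nat set set" where
  "H j = {h. h \<subseteq> E \<and> E - Q j \<subseteq> h \<and> card (h \<inter> Q j) = 2 * N * j}"

definition base :: "nat set set" where "base = (\<Union>j<k. G j \<union> H j)"

lemma finite_Q [simp]: "finite (Q j)" by (simp add: Q_def)

lemma card_Q: "card (Q j) = 2 * N * k + N * j" by (simp add: Q_def)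

lemma Q_mono: "i \<le> j \<Longrightarrow> Q i \<subseteq> Q j" by (auto simp: Q_def)

lemma card_Q_Suc_diff: "card (Q (Suc j) - Q j) = N"
  using Q_mono[of j "Suc j"] by (simp add: card_Diff_subset card_Q)

lemma Q_subset: "j \<le> k \<Longrightarrow> Q j \<subseteq> E - {n}"
proof -
  assume "j \<le> k"
  then have "2 * N * k + N * j \<le> 3 * N * k" using mult_le_mono2[of j k N] by linarith
  then have "1 \<le> x \<and> x < n" if "x \<in> Q j" for x using that large unfolding Q_def atLeastAtMost_iff by linarith
  then show ?thesis by fastforce
qed

lemma nth_le_N: "i < k \<Longrightarrow> ns ! i \<le> N" using leN by simp

lemma U_mono: "U j X \<Longrightarrow> X \<subseteq> Y \<Longrightarrow> U j Y"
  unfolding U_def by (meson Int_mono card_mono finite_Int finite_Q order_refl order_trans)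

text \<open>Passing from \<open>Q (Suc m)\<close> to \<open>Q m\<close> loses at most
  \<open>N\<close> points while the threshold drops by \<open>2 * N\<close>.\<close>

lemma U_antimono:
  assumes "i \<le> j" "U j X" shows "U i X"
  using assms
proof (induction rule: dec_induct)
  case (step m)
  have "X \<inter> Q (Suc m) \<subseteq> (X \<inter> Q m) \<union> (Q (Suc m) - Q m)" by blast
  then have "card (X \<inter> Q (Suc m)) \<le> card (X \<inter> Q m) + N"
    using card_mono[of "(X \<inter> Q m) \<union> (Q (Suc m) - Q m)" "X \<inter> Q (Suc m)"]
      card_Un_le[of "X \<inter> Q m" "Q (Suc m) - Q m"] card_Q_Suc_diff[of m] by simp
  then have "U m X" using step.prems by (simp add: U_def)
  then show ?case by (rule step.IH)
qed

lemma not_U_G: "g \<in> G j \<Longrightarrow> \<not> U j g"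
  by (auto simp: G_def U_def Int_absorb2)

lemma U_H: "h \<in> H j \<Longrightarrow> U j h"
  by (auto simp: H_def U_def)

text \<open>The point \<open>n\<close> tells \<open>G\<close> and \<open>H\<close> apart: a superset
  of a member of \<open>H\<close> contains \<open>n\<close> and so cannot be in
  \<open>G\<close>.\<close>

lemma not_n_in_G: "g \<in> G j \<Longrightarrow> j < k \<Longrightarrow> n \<notin> g"
  using Q_subset[of j] by (auto simp: G_def)

lemma n_in_H: "h \<in> H j \<Longrightarrow> j < k \<Longrightarrow> n \<in> h"
  using Q_subset[of j] large by (auto simp: H_def)

text \<open>\<open>g'\<close> is one point short of the threshold in \<open>Q j'\<close>, and
  \<open>g\<close> supplies a further point of \<open>Q j'\<close>.\<close>

lemma U_Un_G:
  assumes "g \<in> G j" "g' \<in> G j'" "\<not> g \<subseteq> g'" "j \<le> j'" shows "U j' (g \<union> g')"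
proof -
  have "g' \<subset> (g \<union> g') \<inter> Q j'"
    using assms Q_mono[of j j'] by (auto simp: G_def)
  then have "card g' < card ((g \<union> g') \<inter> Q j')" by (simp add: psubset_card_mono)
  then show ?thesis using assms(2) by (simp add: G_def U_def)
qed

text \<open>\<open>h'\<close> meets the threshold in \<open>Q j'\<close> exactly, and intersecting
  with \<open>h\<close> loses a point there.\<close>

lemma not_U_Int_H:
  assumes "h \<in> H j" "h' \<in> H j'" "\<not> h' \<subseteq> h" "j \<le> j'" shows "\<not> U j' (h \<inter> h')"
proof -
  obtain x where x: "x \<in> h'" "x \<notin> h" using assms(3) by blast
  \<comment> \<open>All of \<open>E\<close> outside \<open>Q j'\<close> lies in \<open>h\<close>,
    because \<open>Q j \<subseteq> Q j'\<close>.\<close>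
  then have "x \<in> Q j'" using assms(1,2) Q_mono[OF assms(4)] unfolding H_def by blast
  then have "(h \<inter> h') \<inter> Q j' \<subset> h' \<inter> Q j'" using x by blast
  then have "card ((h \<inter> h') \<inter> Q j') < card (h' \<inter> Q j')" by (simp add: psubset_card_mono)
  then show ?thesis using assms(2) by (simp add: H_def U_def)
qed

lemma base_subset: "base \<subseteq> Pow E"
proof
  fix x assume "x \<in> base"
  then obtain j where "j < k" "x \<subseteq> Q j \<or> x \<subseteq> E" by (auto simp: base_def G_def H_def)
  then show "x \<in> Pow E" using Q_subset[of j] by auto
qed

section \<open>The base family contains no copy\<close>

lemma tower_two:
  assumes "tower ns {..<k} L" "i < k" "x \<in> L i"
  obtains y where "y \<in> L i" "\<not> x \<subseteq> y" "\<not> y \<subseteq> x"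
proof -
  have "card (L i) = ns ! i" "incomparable_family (L i)" using assms by (auto simp: tower_def)
  moreover have "1 < card (L i)" using calculation ge2[of "ns ! i"] assms(2) by simp
  then obtain y where "y \<in> L i" "y \<noteq> x"
    by (metis card.infinite card_le_Suc0_iff_eq leD not_less_zero One_nat_def)
  ultimately show ?thesis using that assms(3) by (metis incomparable_family_def)
qed

lemma tower_nonempty:
  assumes "tower ns {..<k} L" "i < k"
  obtains x where "x \<in> L i"
proof -
  have "card (L i) = ns ! i" using assms by (auto simp: tower_def)
  then have "card (L i) \<noteq> 0" using ge2[of "ns ! i"] assms(2) by simp
  then show ?thesis using that by (metis card.empty ex_in_conv)
qed

text \<open>Each layer inside \<open>G\<close> raises the level by one. Members of layer
  \<open>m\<close> satisfy \<open>U m\<close> by induction, so they lie in some \<open>G j\<close>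
  with \<open>j > m\<close>; the union of two incomparable ones crosses the larger of their two
  thresholds.\<close>

lemma U_if_above_G_tower:
  assumes L: "tower ns {..<k} L" and "m \<le> k"
    and "\<And>i. i < m \<Longrightarrow> L i \<subseteq> (\<Union>j<k. G j)"
    and "\<And>i x. i < m \<Longrightarrow> x \<in> L i \<Longrightarrow> x \<subseteq> S"
  shows "U m S"
  using assms(2-)
proof (induction m arbitrary: S)
  case 0
  then show ?case by (simp add: U_def)
next
  case (Suc m)
  have m: "m < k" using Suc.prems by simp
  have U: "U m x" if "x \<in> L m" for x
  proof (rule Suc.IH)
    show "y \<subseteq> x" if "i < m" "y \<in> L i" for i y
      using tower_le[OF L that(1) _ _ that(2) \<open>x \<in> L m\<close>] that m by simp
  qed (use Suc.prems in auto)
  obtain g where g: "g \<in> L m" using tower_nonempty[OF L m] .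
  obtain g' where g': "g' \<in> L m" "\<not> g \<subseteq> g'" "\<not> g' \<subseteq> g" using tower_two[OF L m g] .
  obtain j j' where j: "g \<in> G j" "g' \<in> G j'" using Suc.prems(2)[of m] g g'(1) by blast
  have jm: "m < j" "m < j'"
    using U[OF g] U[OF g'(1)] not_U_G[OF j(1)] not_U_G[OF j(2)] U_antimono by (meson not_less)+
  have "U (max j j') (g \<union> g')"
    using U_Un_G[OF j g'(2)] U_Un_G[OF j(2,1) g'(3)] by (cases "j \<le> j'") (auto simp: Un_commute)
  then have "U (Suc m) (g \<union> g')" using U_antimono[of "Suc m" "max j j'"] jm by simp
  moreover have "g \<union> g' \<subseteq> S" using Suc.prems(3)[of m] g g'(1) by simp
  ultimately show ?case by (rule U_mono)
qed

text \<open>The dual, descending from the top: members of layer \<open>m\<close> lie in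
  \<open>H j\<close> with \<open>j \<le> m\<close>, since they fail \<open>U (Suc m)\<close> unless
  \<open>m\<close> is the top layer, and the intersection of two incomparable ones fails the larger
  of their two thresholds.\<close>

lemma not_U_if_below_H_tower:
  assumes L: "tower ns {..<k} L" and "m < k"
    and "\<And>i. m \<le> i \<Longrightarrow> i < k \<Longrightarrow> L i \<subseteq> (\<Union>j<k. H j)"
    and "\<And>i x. m \<le> i \<Longrightarrow> i < k \<Longrightarrow> x \<in> L i \<Longrightarrow> S \<subseteq> x"
  shows "\<not> U m S"
  using assms(2-)
proof (induction "k - m" arbitrary: m S)
  case 0
  then show ?case by simp
next
  case (Suc d)
  note m = \<open>m < k\<close>
  have le: "j \<le> m" if x: "x \<in> L m" and j: "x \<in> H j" "j < k" for x j
  proof (cases "Suc m < k")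
    case True
    have "\<not> U (Suc m) x"
    proof (rule Suc.hyps(1))
      show "x \<subseteq> y" if "Suc m \<le> i" "i < k" "y \<in> L i" for i y
        using tower_le[OF L _ _ _ x that(3)] that m by simp
    qed (use Suc.prems Suc.hyps(2) True in auto)
    then show ?thesis using U_H[OF j(1)] U_antimono by (meson not_less_eq_eq)
  next
    case False
    then show ?thesis using j(2) by simp
  qed
  obtain h where h: "h \<in> L m" using tower_nonempty[OF L m] .
  obtain h' where h': "h' \<in> L m" "\<not> h \<subseteq> h'" "\<not> h' \<subseteq> h" using tower_two[OF L m h] .
  obtain j j' where j: "h \<in> H j" "h' \<in> H j'" "j < k" "j' < k"
    using Suc.prems(2)[of m] m h h'(1) by blast
  have "\<not> U (max j j') (h \<inter> h')"
    using not_U_Int_H[OF j(1,2) h'(3)] not_U_Int_H[OF j(2,1) h'(2)]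
    by (cases "j \<le> j'") (auto simp: Int_commute)
  then have "\<not> U m (h \<inter> h')"
    using U_antimono[of "max j j'" m] le[OF h j(1,3)] le[OF h'(1) j(2,4)] by auto
  moreover have "S \<subseteq> h \<inter> h'" using Suc.prems(3)[of m] m h h'(1) by simp
  ultimately show ?case using U_mono by blast
qed

text \<open>Sets above the layers in \<open>G\<close> satisfy \<open>U i\<close>, and sets below the
  later layers in \<open>H\<close> fail \<open>U (Suc i)\<close>. Two incomparable members of the
  transitional layer \<open>i\<close> contradict these bounds or the last condition in
  \<open>G\<close>.\<close>

lemma no_tower_in_base:
  assumes L: "tower ns {..<k} L" and sub: "\<And>i. i < k \<Longrightarrow> L i \<subseteq> base" and "0 < k"
  shows False
proof -
  have le: "x \<subseteq> y" if "i < i'" "i' < k" "x \<in> L i" "y \<in> L i'" for i i' x y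
    using tower_le[OF L that(1) _ _ that(3,4)] that by simp
  \<comment> \<open>With all layers in \<open>G\<close>, a member of the top layer would satisfy
    \<open>U (k - 1)\<close>, hence \<open>U j\<close> for all \<open>j < k\<close>, which no member
    of \<open>G j\<close> does.\<close>
  have "\<exists>i<k. \<not> L i \<subseteq> (\<Union>j<k. G j)"
  proof (rule ccontr)
    assume "\<not> ?thesis"
    then have all: "L i \<subseteq> (\<Union>j<k. G j)" if "i < k" for i using that by blast
    obtain g where g: "g \<in> L (k - 1)" using tower_nonempty[OF L, of "k - 1"] \<open>0 < k\<close> by auto
    have "U (k - 1) g"
      by (rule U_if_above_G_tower[OF L]) (use all le g in auto)
    moreover obtain j where "g \<in> G j" "j < k" using all[of "k - 1"] g \<open>0 < k\<close> by auto
    ultimately show False using not_U_G U_antimono[of j "k - 1" g] by force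
  qed
  then have ex: "\<exists>i. i < k \<and> \<not> L i \<subseteq> (\<Union>j<k. G j)" by simp
  define i where "i = (LEAST i. i < k \<and> \<not> L i \<subseteq> (\<Union>j<k. G j))"
  have i: "i < k" "\<not> L i \<subseteq> (\<Union>j<k. G j)"
    using LeastI_ex[OF ex] unfolding i_def by simp_all
  have G: "L l \<subseteq> (\<Union>j<k. G j)" if "l < i" for l
    using not_less_Least[OF that[unfolded i_def]] that i(1) by simp
  obtain h j where h: "h \<in> L i" "h \<in> H j" "j < k"
    using sub[OF i(1)] i(2) unfolding base_def by blast
  have H: "L l \<subseteq> (\<Union>j<k. H j)" if "i < l" "l < k" for l
  proof
    fix y assume y: "y \<in> L l"
    then have "n \<in> y" using le[OF that h(1)] n_in_H[OF h(2,3)] by blast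
    then show "y \<in> (\<Union>j<k. H j)"
      using sub[OF that(2)] y not_n_in_G unfolding base_def by blast
  qed
  have below: "U i S" if "\<And>l x. l < i \<Longrightarrow> x \<in> L l \<Longrightarrow> x \<subseteq> S" for S
    by (rule U_if_above_G_tower[OF L]) (use i G that in auto)
  have above: "\<not> U (Suc i) S" if "Suc i < k" "\<And>l x. i < l \<Longrightarrow> l < k \<Longrightarrow> x \<in> L l \<Longrightarrow> S \<subseteq> x" for S
    by (rule not_U_if_below_H_tower[OF L]) (use H that in \<open>simp_all add: Suc_le_eq\<close>)
  have small: "j \<le> i" if "x \<in> L i" "x \<in> H j" "j < k" for x j
  proof (cases "Suc i < k")
    case True
    then have "\<not> U (Suc i) x" using above[OF True] le that(1) by blast
    then show ?thesis using U_H[OF that(2)] U_antimono by (meson not_less_eq_eq)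
  qed (use that in simp)
  obtain x where x: "x \<in> L i" "\<not> h \<subseteq> x" "\<not> x \<subseteq> h" using tower_two[OF L i(1) h(1)] .
  have Int: "U i (h \<inter> x)" by (rule below) (use le i h(1) x(1) in auto)
  consider j' where "j' < k" "x \<in> H j'" | l where "l < k" "x \<in> G l"
    using sub[OF i(1)] x(1) unfolding base_def by blast
  then show False
  proof cases
    case 1
    \<comment> \<open>Both indices are at most \<open>i\<close> by \<open>small\<close>, so
      \<open>U i\<close> for the intersection would give \<open>U (max j j')\<close>.\<close>
    have "\<not> U (max j j') (h \<inter> x)"
      using not_U_Int_H[OF h(2) 1(2) x(3)] not_U_Int_H[OF 1(2) h(2) x(2)]
      by (cases "j \<le> j'") (auto simp: Int_commute)
    then show False
      using Int U_antimono[of "max j j'" i] small[OF h] small[OF x(1) 1(2,1)] by auto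
  next
    case 2
    have "U i x" using Int by (rule U_mono) simp
    then have l: "i < l" using not_U_G[OF 2(2)] U_antimono by (meson not_less)
    \<comment> \<open>The union lies below all layers after \<open>i\<close>, so it also misses the
      threshold at \<open>l\<close>. As \<open>x\<close> is only one point short of it,
      \<open>h\<close> adds no new point inside \<open>Q l\<close>.\<close>
    have "\<not> U (Suc i) (h \<union> x)"
      by (rule above) (use l 2(1) le h(1) x(1) in auto)
    then have "\<not> U l (h \<union> x)" using U_antimono[of "Suc i" l] l by auto
    then have "card ((h \<union> x) \<inter> Q l) \<le> card x" using 2(2) by (simp add: U_def G_def)
    moreover have "x \<subseteq> (h \<union> x) \<inter> Q l" using 2(2) by (auto simp: G_def)
    ultimately have eq: "x = (h \<union> x) \<inter> Q l" by (simp add: card_seteq)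
    \<comment> \<open>Since \<open>h\<close> contains everything outside \<open>Q j\<close>, it
      contains \<open>Q l - Q (l - 1)\<close>; then so does \<open>x\<close>, which
      \<open>G l\<close> forbids.\<close>
    have "Q j \<subseteq> Q (l - 1)" using small[OF h] l by (intro Q_mono) simp
    then have "Q l - Q (l - 1) \<subseteq> h"
      using h(2) Q_subset[of l] 2(1) by (auto simp: H_def)
    then have "Q l - Q (l - 1) \<subseteq> x" using eq by blast
    then show False using 2(2) by (simp add: G_def)
  qed
qed

section \<open>Embedding layers below and above a given set\<close>

text \<open>The top layer deletes single points \<open>t \<in> T\<close> from a set
  \<open>X'\<close> exactly at the threshold; the lower layers are placed inside
  \<open>X' - T\<close>.\<close>

lemma tower_below:
  assumes "U m X" "m < k"
  shows "\<exists>L. tower ns {..<m} L \<and> (\<forall>i<m. L i \<subseteq> base \<and> (\<forall>x\<in>L i. x \<subseteq> X))"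
  using assms
proof (induction m arbitrary: X)
  case 0
  then show ?case by (simp add: tower_def)
next
  case (Suc m)
  have m: "m < k" using Suc.prems by simp
  let ?R = "Q (Suc m) - Q m"
  obtain X' where X': "X' \<subseteq> X \<inter> Q (Suc m)" "card X' = 2 * N * Suc m"
    using Suc.prems(1) unfolding U_def by (meson obtain_subset_with_card_n)
  have fin: "finite X'" using X'(1) by (meson finite_Int finite_Q finite_subset)
  \<comment> \<open>Each deletion must leave the ring \<open>?R\<close> not fully covered: if
    \<open>X'\<close> covers it, the deleted points are taken from the ring; otherwise any points of
    \<open>X'\<close> work.\<close>
  have "ns ! m \<le> card (if ?R \<subseteq> X' then ?R else X')"
    using nth_le_N[OF m] card_Q_Suc_diff[of m] X'(2) by (auto split: if_splits)
  then obtain T where T: "T \<subseteq> (if ?R \<subseteq> X' then ?R else X')" "card T = ns ! m"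
    by (meson obtain_subset_with_card_n)
  then have TX: "T \<subseteq> X'" by (auto split: if_splits)
  \<comment> \<open>Discarding \<open>T\<close> and the ring costs at most \<open>2 * N\<close>
    points, exactly the gap between consecutive thresholds.\<close>
  have "X' \<subseteq> ((X' - T) \<inter> Q m) \<union> (T \<union> ?R)" using X'(1) by blast
  then have "card X' \<le> card (((X' - T) \<inter> Q m) \<union> (T \<union> ?R))"
    by (intro card_mono) (use fin finite_subset[OF TX] in auto)
  then have "card X' \<le> card ((X' - T) \<inter> Q m) + card (T \<union> ?R)"
    using card_Un_le[of "(X' - T) \<inter> Q m" "T \<union> ?R"] by linarith
  moreover have "card (T \<union> ?R) \<le> N + N"
    using card_Un_le[of T ?R] T(2) nth_le_N[OF m] card_Q_Suc_diff[of m] by linarith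
  ultimately have "U m (X' - T)" using X'(2) by (simp add: U_def)
  from Suc.IH[OF this m] obtain L where L: "tower ns {..<m} L"
    and Lsub: "\<forall>i<m. L i \<subseteq> base \<and> (\<forall>x\<in>L i. x \<subseteq> X' - T)"
    by (elim exE conjE) (rule that)
  define A where "A = (\<lambda>t. X' - {t}) ` T"
  have "inj_on (\<lambda>t. X' - {t}) T" using TX by (auto simp: inj_on_def)
  then have cA: "card A = ns ! m" using T(2) by (simp add: A_def card_image)
  have iA: "incomparable_family A" using TX by (auto simp: incomparable_family_def A_def)
  have "A \<subseteq> G (Suc m)"
  proof
    fix g assume "g \<in> A"
    then obtain t where t: "t \<in> T" "g = X' - {t}" by (auto simp: A_def)
    have "\<not> ?R \<subseteq> g" using T(1) t by (auto split: if_splits)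
    moreover have "card g + 1 = 2 * N * Suc m"
      using t TX X'(2) fin by (metis Suc_eq_plus1 card_Suc_Diff1 subsetD)
    ultimately show "g \<in> G (Suc m)" using X'(1) t by (auto simp: G_def)
  qed
  then have "A \<subseteq> base" using Suc.prems(2) by (auto simp: base_def)
  moreover have "\<forall>x\<in>A. x \<subseteq> X" using X'(1) by (auto simp: A_def)
  moreover have "tower ns {..<Suc m} (L(m := A))"
    unfolding lessThan_Suc
    by (rule tower_insert[OF L _ cA iA]) (use Lsub in \<open>fastforce simp: A_def\<close>)+
  moreover have "\<forall>i<Suc m. (L(m := A)) i \<subseteq> base \<and> (\<forall>x\<in>(L(m := A)) i. x \<subseteq> X)"
  proof (intro allI impI)
    fix i assume i: "i < Suc m"
    show "(L(m := A)) i \<subseteq> base \<and> (\<forall>x\<in>(L(m := A)) i. x \<subseteq> X)"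
    proof (cases "i = m")
      case False
      then have "L i \<subseteq> base" "\<forall>x\<in>L i. x \<subseteq> X' - T" using Lsub i by (auto simp: less_Suc_eq)
      then show ?thesis using False X'(1) by fastforce
    qed (use calculation in simp)
  qed
  ultimately show ?case by blast
qed

text \<open>The bottom layer adds single points \<open>t \<in> T\<close> to a set
  \<open>W \<supseteq> X\<close> that is one point short of the threshold in \<open>Q m\<close>; the
  higher layers are placed above \<open>W \<union> T\<close>.\<close>

lemma tower_above:
  assumes "\<not> U m X" "m < k" "X \<subseteq> E"
  shows "\<exists>L. tower ns {m..<k} L \<and> (\<forall>i\<in>{m..<k}. L i \<subseteq> base \<and> (\<forall>x\<in>L i. X \<subseteq> x))"
  using assms
proof (induction "k - m" arbitrary: m X)
  case 0
  then show ?case by simp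
next
  case (Suc d)
  note m = \<open>m < k\<close>
  have less: "card (X \<inter> Q m) < 2 * N * m" using Suc.prems(1) by (simp add: U_def)
  have mk: "N * m + N \<le> N * k"
    using mult_le_mono2[of "Suc m" k N] m by simp
  \<comment> \<open>The subtraction is not truncated, because \<open>less\<close> makes
    \<open>2 * N * m\<close> positive.\<close>
  obtain Z where Z: "X \<inter> Q m \<subseteq> Z" "Z \<subseteq> Q m" "card Z = 2 * N * m - 1"
  proof (rule exE[OF exists_subset_between[of "X \<inter> Q m" "2 * N * m - 1" "Q m"]])
    show "card (X \<inter> Q m) \<le> 2 * N * m - 1" using less by linarith
    show "2 * N * m - 1 \<le> card (Q m)" using mk unfolding card_Q by linarith
  qed (use that in auto)
  have finZ: "finite Z" using Z(2) by (rule finite_subset) simp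
  have "ns ! m \<le> card (Q m - Z)"
    using Z finZ mk nth_le_N[OF m] by (simp add: card_Diff_subset card_Q)
  then obtain T where T: "T \<subseteq> Q m - Z" "card T = ns ! m" by (meson obtain_subset_with_card_n)
  have finT: "finite T" using T(1) by (rule finite_subset) simp
  define W where "W = Z \<union> (E - Q m)"
  have QE: "Q m \<subseteq> E" using Q_subset[of m] m by auto
  have XW: "X \<subseteq> W" using Z(1) Suc.prems(3) by (auto simp: W_def)
  have WE: "W \<union> T \<subseteq> E" using Z(2) T(1) QE by (auto simp: W_def)
  define A where "A = (\<lambda>t. insert t W) ` T"
  have TW: "T \<inter> W = {}" using T(1) by (auto simp: W_def)
  have "inj_on (\<lambda>t. insert t W) T" using TW by (auto simp: inj_on_def)
  then have cA: "card A = ns ! m" using T(2) by (simp add: A_def card_image)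
  have iA: "incomparable_family A" using TW by (auto simp: incomparable_family_def A_def)
  have "A \<subseteq> H m"
  proof
    fix h assume "h \<in> A"
    then obtain t where t: "t \<in> T" "h = insert t W" by (auto simp: A_def)
    have "h \<inter> Q m = insert t Z" using t T(1) Z(2) by (auto simp: W_def)
    moreover have "card (insert t Z) = 2 * N * m"
      using t T(1) Z(3) finZ less by (subst card_insert_disjoint) auto
    ultimately show "h \<in> H m" using t WE by (auto simp: H_def W_def)
  qed
  then have Ab: "A \<subseteq> base" using m by (auto simp: base_def)
  have AX: "\<forall>x\<in>A. X \<subseteq> x" using XW by (auto simp: A_def)
  have "\<exists>L. tower ns {Suc m..<k} L \<and>
      (\<forall>i\<in>{Suc m..<k}. L i \<subseteq> base \<and> (\<forall>x\<in>L i. W \<union> T \<subseteq> x))"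
  proof (cases "Suc m < k")
    case True
    \<comment> \<open>The trace grows from \<open>2 * N * m - 1\<close> by at most
      \<open>2 * N\<close>, staying below the next threshold.\<close>
    have "(W \<union> T) \<inter> Q (Suc m) \<subseteq> Z \<union> (T \<union> (Q (Suc m) - Q m))"
      by (auto simp: W_def)
    then have "card ((W \<union> T) \<inter> Q (Suc m)) \<le> card (Z \<union> (T \<union> (Q (Suc m) - Q m)))"
      by (intro card_mono) (use finZ finT in auto)
    also have "\<dots> \<le> card Z + (card T + N)"
      using card_Un_le[of Z "T \<union> (Q (Suc m) - Q m)"] card_Un_le[of T "Q (Suc m) - Q m"]
        card_Q_Suc_diff[of m] by linarith
    also have "\<dots> < 2 * N * Suc m"
      using Z(3) T(2) nth_le_N[OF m] less by simp
    finally have "\<not> U (Suc m) (W \<union> T)" by (simp add: U_def)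
    then show ?thesis using Suc.hyps(1)[of "Suc m" "W \<union> T"] Suc.hyps(2) True WE by simp
  next
    case False
    then show ?thesis by (simp add: tower_def)
  qed
  then obtain L where L: "tower ns {Suc m..<k} L"
    and Lsub: "\<forall>i\<in>{Suc m..<k}. L i \<subseteq> base \<and> (\<forall>x\<in>L i. W \<union> T \<subseteq> x)" by blast
  have split: "{m..<k} = insert m {Suc m..<k}" using m by auto
  have AWT: "x \<subseteq> W \<union> T" if "x \<in> A" for x using that by (auto simp: A_def)
  have "tower ns {m..<k} (L(m := A))"
    unfolding split by (rule tower_insert[OF L _ cA iA]) (use Lsub AWT in fastforce)+
  moreover have "\<forall>i\<in>{m..<k}. (L(m := A)) i \<subseteq> base \<and> (\<forall>x\<in>(L(m := A)) i. X \<subseteq> x)"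
  proof
    fix i assume i: "i \<in> {m..<k}"
    show "(L(m := A)) i \<subseteq> base \<and> (\<forall>x\<in>(L(m := A)) i. X \<subseteq> x)"
    proof (cases "i = m")
      case False
      then have "L i \<subseteq> base" "\<forall>x\<in>L i. W \<union> T \<subseteq> x" using bspec[OF Lsub, of i] i by simp_all
      then show ?thesis using False XW by fastforce
    qed (use Ab AX in simp)
  qed
  ultimately show ?case by blast
qed

section \<open>Counting by traces and the linear bound\<close>

text \<open>Every member with trace \<open>X\<close> lies between \<open>X\<close> and
  \<open>X \<union> (E - Q k)\<close>. With \<open>p\<close> the last level that \<open>X\<close>
  reaches below \<open>k\<close>, an antichain of size \<open>ns ! p\<close> among these members
  would fill the one missing layer of a copy.\<close>

lemma card_fibre_le:
  assumes F: "base \<subseteq> F" "F \<subseteq> Pow E" and "0 < k"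
    and free: "\<not> contains_induced_copy (inclusion_order F) (complete_layered_poset ns)"
  shows "card {S \<in> F. S \<inter> Q k = X} \<le> N * (n + 1)"
proof (cases "X \<subseteq> Q k")
  case False
  then have "{S \<in> F. S \<inter> Q k = X} = {}" by blast
  then show ?thesis by (metis card.empty le0)
next
  case X: True
  obtain p where p: "p < k" "U p X" "Suc p < k \<Longrightarrow> \<not> U (Suc p) X"
  proof -
    define p where "p = (GREATEST p. p < k \<and> U p X)"
    have "0 < k \<and> U 0 X" using \<open>0 < k\<close> by (simp add: U_def)
    then have "p < k \<and> U p X"
      unfolding p_def by (rule GreatestI_nat[where b = k]) simp
    moreover have "\<not> (Suc p < k \<and> U (Suc p) X)"
      using Greatest_le_nat[of "\<lambda>p. p < k \<and> U p X" "Suc p" k] unfolding p_def by auto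
    ultimately show thesis using that by blast
  qed
  obtain L1 where L1: "tower ns {..<p} L1"
    "\<And>i x. i < p \<Longrightarrow> x \<in> L1 i \<Longrightarrow> x \<in> base \<and> x \<subseteq> X"
    using tower_below[OF p(2,1)] by (metis subsetD)
  have "\<exists>L. tower ns {Suc p..<k} L \<and>
      (\<forall>i\<in>{Suc p..<k}. L i \<subseteq> base \<and> (\<forall>x\<in>L i. X \<union> (E - Q k) \<subseteq> x))"
  proof (cases "Suc p < k")
    case True
    \<comment> \<open>Points outside \<open>Q k\<close> leave the trace on \<open>Q (Suc p)\<close>
      unchanged, so \<open>X\<close> may be enlarged by all of them.\<close>
    have "(X \<union> (E - Q k)) \<inter> Q (Suc p) = X \<inter> Q (Suc p)"
      using Q_mono[of "Suc p" k] True by auto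
    then have "\<not> U (Suc p) (X \<union> (E - Q k))" using p(3)[OF True] by (simp add: U_def)
    moreover have "X \<union> (E - Q k) \<subseteq> E" using X Q_subset[of k] by auto
    ultimately show ?thesis using tower_above True by blast
  next
    case False
    then show ?thesis by (simp add: tower_def)
  qed
  then obtain L2 where L2: "tower ns {Suc p..<k} L2"
    and L2_sub: "\<forall>i\<in>{Suc p..<k}. L2 i \<subseteq> base \<and> (\<forall>x\<in>L2 i. X \<union> (E - Q k) \<subseteq> x)"
    by (elim exE conjE) (rule that)
  have L2_above: "x \<in> base \<and> X \<union> (E - Q k) \<subseteq> x" if "p < i" "i < k" "x \<in> L2 i" for i x
    using bspec[OF L2_sub, of i] that by auto
  have "card {S \<in> F. S \<inter> Q k = X} \<le> ns ! p * (n + 1)"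
  proof (rule card_le_if_no_large_incomparable_subfamily)
    show "{S \<in> F. S \<inter> Q k = X} \<subseteq> Pow E" using F(2) by blast
    fix A assume A: "A \<subseteq> {S \<in> F. S \<inter> Q k = X}" "incomparable_family A"
    show "card A \<noteq> ns ! p"
    proof
      assume cA: "card A = ns ! p"
      define L where "L i = (if i < p then L1 i else if i = p then A else L2 i)" for i
      have bounds: "X \<subseteq> S \<and> S \<subseteq> X \<union> (E - Q k)" if "S \<in> A" for S
        using that A(1) F(2) by blast
      have "x \<subseteq> y" if ij: "i < j" "j < k" and xy: "x \<in> L i" "y \<in> L j" for i j x y
      proof -
        consider "j < p" | "i < p" "j = p" | "i < p" "p < j" | "i = p" | "p < i"
          using ij by linarith
        then show ?thesis
        proof cases
          case 1
          then show ?thesis using tower_le[OF L1(1) ij(1), of x y] ij xy by (simp add: L_def)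
        next
          case 2
          then show ?thesis using L1(2)[of i x] bounds[of y] xy by (auto simp: L_def)
        next
          case 3
          then show ?thesis using L1(2)[of i x] L2_above[of j y] ij xy by (auto simp: L_def)
        next
          case 4
          then show ?thesis using bounds[of x] L2_above[of j y] ij xy by (auto simp: L_def)
        next
          case 5
          then show ?thesis using tower_le[OF L2 ij(1), of x y] ij xy by (simp add: L_def)
        qed
      qed
      moreover have "card (L i) = ns ! i \<and> incomparable_family (L i)" if "i < k" for i
        using L1(1) L2 A(2) cA that by (auto simp: tower_def L_def)
      ultimately have "tower ns {..<k} L" by (auto simp: tower_def)
      moreover have "L i \<subseteq> F" if "i < k" for i
        using L1(2)[of i] L2_above[of i] A(1) F(1) that unfolding L_def
        by (cases i p rule: linorder_cases) auto
      ultimately show False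
        using free tower_imp_contains_induced_copy[of ns L F] ge2 by simp
    qed
  qed
  also have "\<dots> \<le> N * (n + 1)" using nth_le_N[OF p(1)] by (rule mult_le_mono1)
  finally show ?thesis .
qed

text \<open>There are \<open>2 ^ (3 * N * k)\<close> traces on \<open>Q k\<close>, a number
  independent of \<open>n\<close>, each shared by linearly many members.\<close>

lemma sat_star_bound:
  assumes "0 < k"
  shows "sat_star n (complete_layered_poset ns) \<le> 2 ^ (3 * N * k) * (N * (n + 1))"
proof -
  have "\<not> contains_induced_copy (inclusion_order base) (complete_layered_poset ns)"
  proof
    assume "contains_induced_copy (inclusion_order base) (complete_layered_poset ns)"
    from contains_induced_copy_imp_tower[OF this]
    obtain L where "tower ns {..<k} L" "\<forall>i<k. L i \<subseteq> base" by (elim exE conjE) (rule that)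
    then show False using no_tower_in_base[of L] assms by simp
  qed
  from ex_saturated_superset[OF base_subset this]
  obtain F where F: "base \<subseteq> F" "saturated n (complete_layered_poset ns) F"
    by (elim exE conjE) (rule that)
  have "F = (\<Union>X\<in>Pow (Q k). {S \<in> F. S \<inter> Q k = X})" by auto
  then have "card F \<le> (\<Sum>X\<in>Pow (Q k). card {S \<in> F. S \<inter> Q k = X})"
    using card_UN_le[of "Pow (Q k)" "\<lambda>X. {S \<in> F. S \<inter> Q k = X}"] by simp
  also have "\<dots> \<le> of_nat (card (Pow (Q k))) * (N * (n + 1))"
    by (rule sum_bounded_above) (use card_fibre_le[OF F(1)] F(2) assms in \<open>simp add: saturated_def\<close>)
  also have "\<dots> = 2 ^ (3 * N * k) * (N * (n + 1))" by (simp add: card_Pow card_Q)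
  finally show ?thesis using sat_star_le[OF F(2)] by linarith
qed

end

theorem theorem4p1:
  fixes ns :: "nat list"
  assumes "length ns \<ge> 1"
    and "\<forall>m\<in>set ns. m \<ge> 2"
  shows "(\<lambda>n. real (sat_star n (complete_layered_poset ns))) \<in> O(\<lambda>n. real n)"
proof -
  \<comment> \<open>The largest layer size depends on \<open>ns\<close> alone, so \<open>C\<close>
    is constant in \<open>n\<close>.\<close>
  define N where "N = Max (set ns)"
  define C where "C = 2 ^ (3 * N * length ns) * N"
  have "sat_star n (complete_layered_poset ns) \<le> 2 * C * n" if "3 * N * length ns < n" for n
  proof -
    interpret layered_construction ns N n
      by unfold_locales (use assms(2) that in \<open>auto simp: N_def\<close>)
    have "sat_star n (complete_layered_poset ns) \<le> C * (n + 1)"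
      using sat_star_bound assms(1) unfolding C_def mult.assoc by linarith
    also have "\<dots> \<le> C * (2 * n)" using that by (intro mult_le_mono2) simp
    finally show ?thesis by (simp add: mult.commute mult.left_commute)
  qed
  then have "norm (real (sat_star n (complete_layered_poset ns))) \<le> real (2 * C) * norm (real n)"
    if "3 * N * length ns < n" for n
    using that by (metis norm_of_nat of_nat_le_iff of_nat_mult)
  then show ?thesis
    by (intro bigoI[of _ "real (2 * C)"] eventually_mono[OF eventually_gt_at_top[of "3 * N * length ns"]]) blast
qed

end
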